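(* Let $\mathcal{F}=(\blacksquare;w_1,\dots,w_N)$ be the bilinear iterated function system described in the context, and let $\lambda_n$ denote the Lipschitz constant of the affine map $l_n$, $n=1,\dots,N$. Then $\mathcal{F}$ is contractive in the metric $$d_1((x,y),(x',y'))=\alpha|x-x'|+\beta\,|(y-1)-(y'-1)|$$ on $\blacksquare$ with $\alpha=1$ and any $\beta$ satisfying $0<\beta<\frac{1-\lambda_n}{2}$ for all $n=1,\dots,N$.
   Context: Let $N>1$ be an integer, $I=[0,1]$ and $\blacksquare=I\times I$. Let $0=X_0<X_1<\cdots<X_N=1$, and let $\underline{Y}_j,\overline{Y}_j\in I$, $j=0,1,\dots,N$, satisfy $0\le\underline{Y}_j\le\overline{Y}_j<1$ for all $j$. Put $s_j=\overline{Y}_j-\underline{Y}_j$ (so $0\le s_j<1$), $j=0,\dots,N$, and $a_n=\underline{Y}_n-\underline{Y}_{n-1}$, $n=1,\dots,N$. For $n=1,\dots,N$ let $l_n:I\to[X_{n-1},X_n]$, $l_n(x)=X_{n-1}+(X_n-X_{n-1})x$, and $$B_n(x,y)=a_nx+[s_{n-1}+(s_n-s_{n-1})x]\,y+\underline{Y}_{n-1}.$$ Set $w_n(x,y)=(l_n(x),B_n(x,y))$. Then $w_n$ maps $\blacksquare$ onto the trapezoid with vertices $(X_{n-1},\underline{Y}_{n-1})$, $(X_n,\underline{Y}_n)$, $(X_n,\overline{Y}_n)$, $(X_{n-1},\overline{Y}_{n-1})$, which are the images of $(0,0)$, $(1,0)$, $(1,1)$, $(0,1)$ respectively. The family $\mathcal{F}=(\blacksquare;w_1,\dots,w_N)$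 is called a bilinear IFS. An IFS $(\mathbb{Y};f_1,\dots,f_N)$ on a complete metric space $(\mathbb{Y},d)$ is contractive in $d$ if there is $c\in[0,1)$ with $d(f_n(u),f_n(v))\le c\,d(u,v)$ for all $u,v\in\mathbb{Y}$ and all $n$. *)

theory Defs
  imports "HOL-Analysis.Analysis"
begin

definition is_ifs :: "'a set \<Rightarrow> ('a \<Rightarrow> 'a \<Rightarrow> real) \<Rightarrow> nat \<Rightarrow> (nat \<Rightarrow> 'a \<Rightarrow> 'a) \<Rightarrow> bool" where
  "is_ifs Y d N f \<longleftrightarrow>
     Metric_space Y d \<and> Metric_space.mcomplete Y d \<and>
     (\<forall>n\<in>{1..N}. continuous_map (Metric_space.mtopology Y d) (Metric_space.mtopology Y d) (f n))"

definition contractive_ifs ::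
    "'a set \<Rightarrow> ('a \<Rightarrow> 'a \<Rightarrow> real) \<Rightarrow> nat \<Rightarrow> (nat \<Rightarrow> 'a \<Rightarrow> 'a) \<Rightarrow> bool" where
  "contractive_ifs Y d N f \<longleftrightarrow>
     is_ifs Y d N f \<and>
     (\<exists>c. 0 \<le> c \<and> c < 1 \<and>
        (\<forall>n\<in>{1..N}. \<forall>u\<in>Y. \<forall>v\<in>Y. d (f n u) (f n v) \<le> c * d u v))"

text \<open>Junk value if no Lipschitz bound exists; the affine maps below always have one.\<close>

definition lipschitz_const :: "'a::metric_space set \<Rightarrow> ('a \<Rightarrow> 'b::metric_space) \<Rightarrow> real" where
  "lipschitz_const S f = Inf {C. C-lipschitz_on S f}"

definition unit_square :: "(real \<times> real) set" where
  "unit_square = {0..1} \<times> {0..1}"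

text \<open>Below, \<open>Yl\<close> and \<open>Yu\<close> are the lower and upper ordinates at the nodes
  \<open>X\<close>. The maps are meant for indices \<open>n \<ge> 1\<close> only.\<close>

definition bil_s :: "(nat \<Rightarrow> real) \<Rightarrow> (nat \<Rightarrow> real) \<Rightarrow> nat \<Rightarrow> real" where
  "bil_s Yl Yu j = Yu j - Yl j"

definition bil_a :: "(nat \<Rightarrow> real) \<Rightarrow> nat \<Rightarrow> real" where
  "bil_a Yl n = Yl n - Yl (n - 1)"

definition bil_l :: "(nat \<Rightarrow> real) \<Rightarrow> nat \<Rightarrow> real \<Rightarrow> real" where
  "bil_l X n x = X (n - 1) + (X n - X (n - 1)) * x"

definition bil_B :: "(nat \<Rightarrow> real) \<Rightarrow> (nat \<Rightarrow> real) \<Rightarrow> nat \<Rightarrow> real \<Rightarrow> real \<Rightarrow> real" where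
  "bil_B Yl Yu n x y =
     bil_a Yl n * x +
     (bil_s Yl Yu (n - 1) + (bil_s Yl Yu n - bil_s Yl Yu (n - 1)) * x) * y +
     Yl (n - 1)"

definition bil_w ::
    "(nat \<Rightarrow> real) \<Rightarrow> (nat \<Rightarrow> real) \<Rightarrow> (nat \<Rightarrow> real) \<Rightarrow> nat \<Rightarrow> real \<times> real \<Rightarrow> real \<times> real" where
  "bil_w X Yl Yu n = (\<lambda>(x, y). (bil_l X n x, bil_B Yl Yu n x y))"

definition d1 :: "real \<Rightarrow> real \<Rightarrow> real \<times> real \<Rightarrow> real \<times> real \<Rightarrow> real" where
  "d1 \<alpha> \<beta> = (\<lambda>(x, y) (x', y'). \<alpha> * \<bar>x - x'\<bar> + \<beta> * \<bar>(y - 1) - (y' - 1)\<bar>)"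

end

theory Submission
  imports Defs
begin

text \<open>
  Write \<open>p j y = Yl j + s j * y\<close> for the affine map of the unit interval onto the vertical
  segment \<open>[Yl j, Yu j]\<close>.  The second component of \<open>w\<^sub>n\<close> interpolates linearly between two
  consecutive ones: \<open>B\<^sub>n x y = (1 - x) * p (n - 1) y + x * p n y\<close>.  Two bounds follow.
  In \<open>y\<close> the slope of \<open>B\<^sub>n\<close> is a convex combination of \<open>s (n - 1)\<close> and \<open>s n\<close>, hence at most
  their maximum, which is less than 1.  In \<open>x\<close> the slope is a difference of two values in
  \<open>[0, 1]\<close>, hence at most 1 in modulus: this is not a contraction, but it is harmless once it is
  weighted with a small \<open>\<beta>\<close>.  Indeed, with \<open>\<lambda>\<^sub>n\<close> the slope of \<open>l\<^sub>n\<close>, the distance of two image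
  points is at most \<open>(\<lambda>\<^sub>n + \<beta>) * \<bar>x - x'\<bar> + \<beta> * max (s (n - 1)) (s n) * \<bar>y - y'\<bar>\<close>
  (lemma \<open>bil_w_d1_le\<close>), and \<open>\<beta> < (1 - \<lambda>\<^sub>n) / 2\<close> together with \<open>\<beta> > 0\<close> gives
  \<open>\<lambda>\<^sub>n + \<beta> < 1\<close>.  So \<open>w\<^sub>n\<close> contracts by the factor \<open>max (\<lambda>\<^sub>n + \<beta>) (max (s (n - 1)) (s n))\<close>, and
  the largest of these finitely many factors serves for the whole system.

  That the square is complete for the weighted metric comes from the equivalence of this metric
  with the Euclidean one; continuity of the maps comes from the contraction estimates.
\<close>

section \<open>Contractive systems and equivalent metrics\<close>

lemma Lipschitz_imp_continuous_map_mtopology: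
  assumes M: "Metric_space M d" and maps: "f ` M \<subseteq> M"
    and lip: "\<And>u v. u \<in> M \<Longrightarrow> v \<in> M \<Longrightarrow> d (f u) (f v) \<le> c * d u v"
  shows "continuous_map (Metric_space.mtopology M d) (Metric_space.mtopology M d) f"
  unfolding Metric_space.metric_continuous_map[OF M M]
proof (intro conjI ballI allI impI)
  fix a and \<epsilon> :: real
  assume a: "a \<in> M" and \<epsilon>: "0 < \<epsilon>"
  show "\<exists>\<delta>>0. \<forall>x. x \<in> M \<and> d a x < \<delta> \<longrightarrow> d (f a) (f x) < \<epsilon>"
  proof (intro exI[of _ "\<epsilon> / (\<bar>c\<bar> + 1)"] conjI allI impI)
    show "0 < \<epsilon> / (\<bar>c\<bar> + 1)" using \<epsilon> by simp
    fix x assume x: "x \<in> M \<and> d a x < \<epsilon> / (\<bar>c\<bar> + 1)"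
    have nonneg: "0 \<le> d a x" by (rule Metric_space.nonneg[OF M])
    have "d (f a) (f x) \<le> c * d a x" using a x lip by blast
    also have "\<dots> \<le> (\<bar>c\<bar> + 1) * d a x" using nonneg by (intro mult_right_mono) auto
    also have "\<dots> < \<epsilon>" using x by (simp add: pos_less_divide_eq mult.commute)
    finally show "d (f a) (f x) < \<epsilon>" .
  qed
qed (rule maps)

text \<open>Since there are only finitely many maps, each may come with its own contraction factor.\<close>

lemma contractive_ifsI:
  assumes M: "Metric_space Y d" and complete: "Metric_space.mcomplete Y d"
    and maps: "\<And>n. n \<in> {1..N} \<Longrightarrow> f n ` Y \<subseteq> Y"
    and lt1: "\<And>n. n \<in> {1..N} \<Longrightarrow> c n < 1"
    and contr: "\<And>n u v. n \<in> {1..N} \<Longrightarrow> u \<in> Y \<Longrightarrow> v \<in> Y \<Longrightarrow> d (f n u) (f n v) \<le> c n * d u v"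
  shows "contractive_ifs Y d N f"
proof -
  (* Adjoining 0 makes the maximum nonnegative and well defined even for an empty family. *)
  define C where "C = Max (insert 0 (c ` {1..N}))"
  have "0 \<le> C" unfolding C_def by (intro Max_ge) auto
  moreover have "C < 1" unfolding C_def using lt1 by (subst Max_less_iff) auto
  moreover have "d (f n u) (f n v) \<le> C * d u v" if "n \<in> {1..N}" "u \<in> Y" "v \<in> Y" for n u v
  proof -
    have "c n \<le> C" unfolding C_def using that by (intro Max_ge) auto
    then have "c n * d u v \<le> C * d u v"
      using Metric_space.nonneg[OF M] by (intro mult_right_mono) auto
    with contr[OF that] show ?thesis by linarith
  qed
  moreover have "is_ifs Y d N f"
    unfolding is_ifs_def
    using M complete Lipschitz_imp_continuous_map_mtopology[OF M maps contr] by blast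
  ultimately show ?thesis unfolding contractive_ifs_def by blast
qed

lemma mcomplete_if_equivalent_to_dist:
  fixes S :: "'a::metric_space set" and d :: "'a \<Rightarrow> 'a \<Rightarrow> real"
  assumes M: "Metric_space S d" and "complete S" and "0 < A" and "0 < B"
    and dist_le: "\<And>u v. u \<in> S \<Longrightarrow> v \<in> S \<Longrightarrow> dist u v \<le> A * d u v"
    and le_dist: "\<And>u v. u \<in> S \<Longrightarrow> v \<in> S \<Longrightarrow> d u v \<le> B * dist u v"
  shows "Metric_space.mcomplete S d"
  unfolding Metric_space.mcomplete_def[OF M]
proof (intro allI impI)
  fix \<sigma> assume \<sigma>: "Metric_space.MCauchy S d \<sigma>"
  then have in_S: "\<sigma> n \<in> S" for n
    unfolding Metric_space.MCauchy_def[OF M] by blast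
  have "Cauchy \<sigma>"
  proof (rule metric_CauchyI)
    fix e :: real assume "0 < e"
    then have "0 < e / A" using \<open>0 < A\<close> by simp
    then obtain K where K: "\<And>m n. K \<le> m \<Longrightarrow> K \<le> n \<Longrightarrow> d (\<sigma> m) (\<sigma> n) < e / A"
      using \<sigma> unfolding Metric_space.MCauchy_def[OF M] by meson
    have "dist (\<sigma> m) (\<sigma> n) < e" if "K \<le> m" "K \<le> n" for m n
      using dist_le[OF in_S in_S, of m n] K[OF that] \<open>0 < A\<close>
      by (simp add: pos_less_divide_eq mult.commute)
    then show "\<exists>K. \<forall>m\<ge>K. \<forall>n\<ge>K. dist (\<sigma> m) (\<sigma> n) < e" by blast
  qed
  then obtain l where l: "l \<in> S" "\<sigma> \<longlonglongrightarrow> l"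
    using \<open>complete S\<close> in_S unfolding complete_def by blast
  have "\<exists>K. \<forall>n\<ge>K. \<sigma> n \<in> S \<and> d (\<sigma> n) l < e" if "0 < e" for e
  proof -
    have "0 < e / B" using that \<open>0 < B\<close> by simp
    then obtain K where K: "\<And>n. K \<le> n \<Longrightarrow> dist (\<sigma> n) l < e / B"
      using l(2) unfolding lim_sequentially by meson
    have "d (\<sigma> n) l < e" if "K \<le> n" for n
      using le_dist[OF in_S l(1), of n] K[OF that] \<open>0 < B\<close>
      by (simp add: pos_less_divide_eq mult.commute)
    then show ?thesis using in_S by blast
  qed
  then show "\<exists>l. limitin (Metric_space.mtopology S d) \<sigma> l sequentially"
    unfolding Metric_space.limit_metric_sequentially[OF M] using l(1) by blast
qed

section \<open>The weighted taxicab metric on the square\<close>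

lemma Metric_space_d1:
  assumes "0 < \<alpha>" and "0 < \<beta>"
  shows "Metric_space S (d1 \<alpha> \<beta>)"
proof
  fix u v w :: "real \<times> real"
  show "0 \<le> d1 \<alpha> \<beta> u v"
    using assms by (simp add: d1_def split: prod.split)
  show "d1 \<alpha> \<beta> u v = d1 \<alpha> \<beta> v u"
    by (simp add: d1_def abs_minus_commute split: prod.split)
  show "(d1 \<alpha> \<beta> u v = 0) = (u = v)"
    using assms by (cases u, cases v) (simp add: d1_def add_nonneg_eq_0_iff)
  show "d1 \<alpha> \<beta> u w \<le> d1 \<alpha> \<beta> u v + d1 \<alpha> \<beta> v w"
  proof -
    have "\<alpha> * \<bar>fst u - fst w\<bar> \<le> \<alpha> * (\<bar>fst u - fst v\<bar> + \<bar>fst v - fst w\<bar>)"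
      using assms by (intro mult_left_mono) auto
    moreover have "\<beta> * \<bar>snd u - snd w\<bar> \<le> \<beta> * (\<bar>snd u - snd v\<bar> + \<bar>snd v - snd w\<bar>)"
      using assms by (intro mult_left_mono) auto
    ultimately show ?thesis
      by (simp add: d1_def case_prod_beta distrib_left)
  qed
qed

lemma mcomplete_d1_unit_square:
  assumes "0 < \<alpha>" and "0 < \<beta>"
  shows "Metric_space.mcomplete unit_square (d1 \<alpha> \<beta>)"
proof (rule mcomplete_if_equivalent_to_dist)
  show "Metric_space unit_square (d1 \<alpha> \<beta>)" by (rule Metric_space_d1[OF assms])
  show "complete unit_square"
    unfolding unit_square_def by (intro compact_imp_complete compact_Times compact_Icc)
  show "0 < 1 / \<alpha> + 1 / \<beta>" "0 < \<alpha> + \<beta>" using assms by (auto intro: add_pos_pos)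
  fix u v :: "real \<times> real"
  define p q where "p = \<bar>fst u - fst v\<bar>" and "q = \<bar>snd u - snd v\<bar>"
  have pq: "0 \<le> p" "0 \<le> q" by (auto simp: p_def q_def)
  have d1: "d1 \<alpha> \<beta> u v = \<alpha> * p + \<beta> * q"
    by (simp add: d1_def case_prod_beta p_def q_def)
  have dist: "dist u v = sqrt (p\<^sup>2 + q\<^sup>2)"
    by (simp add: dist_prod_def dist_real_def p_def q_def)
  have "dist u v \<le> p + q"
    unfolding dist using pq by (intro sqrt_sum_squares_le_sum)
  also have "\<dots> \<le> (1 / \<alpha> + 1 / \<beta>) * (\<alpha> * p + \<beta> * q)"
    using assms pq by (simp add: field_simps)
  finally show "dist u v \<le> (1 / \<alpha> + 1 / \<beta>) * d1 \<alpha> \<beta> u v" by (simp only: d1)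
  have "p \<le> dist u v" "q \<le> dist u v"
    unfolding dist by (auto intro: real_le_rsqrt)
  then have "\<alpha> * p + \<beta> * q \<le> \<alpha> * dist u v + \<beta> * dist u v"
    using assms by (intro add_mono mult_left_mono) auto
  then show "d1 \<alpha> \<beta> u v \<le> (\<alpha> + \<beta>) * dist u v"
    by (simp add: d1 distrib_right)
qed

section \<open>Estimates for the bilinear maps\<close>

lemma slope_le_lipschitz_const_bil_l: "X n - X (n - 1) \<le> lipschitz_const {0..1} (bil_l X n)"
  unfolding lipschitz_const_def
proof (rule cInf_greatest)
  have "\<bar>X n - X (n - 1)\<bar>-lipschitz_on {0..1} (bil_l X n)"
    by (rule lipschitz_onI)
      (auto simp: bil_l_def dist_real_def simp flip: right_diff_distrib abs_mult)
  then show "{C. C-lipschitz_on {0..1} (bil_l X n)} \<noteq> {}" by blast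
  fix C assume "C \<in> {C. C-lipschitz_on {0..1} (bil_l X n)}"
  then have "dist (bil_l X n 1) (bil_l X n 0) \<le> C * dist (1::real) 0"
    by (intro lipschitz_onD[of C "{0..1}"]) auto
  then show "X n - X (n - 1) \<le> C"
    by (simp add: bil_l_def dist_real_def)
qed

lemma bil_B_eq_convex_combination:
  "bil_B Yl Yu n x y =
     (1 - x) * (Yl (n - 1) + bil_s Yl Yu (n - 1) * y) + x * (Yl n + bil_s Yl Yu n * y)"
  by (simp add: bil_B_def bil_a_def algebra_simps)

lemma vertical_segment_in_unit_interval:
  assumes "0 \<le> Yl j" "Yl j \<le> Yu j" "Yu j \<le> 1" and "y \<in> {0..1}"
  shows "Yl j + bil_s Yl Yu j * y \<in> {0..1}"
proof -
  have "0 \<le> bil_s Yl Yu j * y" "bil_s Yl Yu j * y \<le> bil_s Yl Yu j"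
    using assms by (auto simp: bil_s_def intro: mult_left_le)
  then show ?thesis using assms by (auto simp: bil_s_def)
qed

lemma bil_w_in_unit_square:
  assumes X: "0 \<le> X (n - 1)" "X (n - 1) \<le> X n" "X n \<le> 1"
    and Y: "\<And>j. j \<in> {n - 1, n} \<Longrightarrow> 0 \<le> Yl j \<and> Yl j \<le> Yu j \<and> Yu j \<le> 1"
  shows "bil_w X Yl Yu n ` unit_square \<subseteq> unit_square"
proof -
  have "bil_l X n x \<in> {0..1} \<and> bil_B Yl Yu n x y \<in> {0..1}"
    if x: "x \<in> {0..1}" and y: "y \<in> {0..1}" for x y
  proof
    have "0 \<le> (X n - X (n - 1)) * x" "(X n - X (n - 1)) * x \<le> X n - X (n - 1)"
      using X x by (auto intro: mult_left_le)
    then show "bil_l X n x \<in> {0..1}" using X by (auto simp: bil_l_def)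
    have "Yl j + bil_s Yl Yu j * y \<in> {0..1}" if "j \<in> {n - 1, n}" for j
      using Y[OF that] y by (intro vertical_segment_in_unit_interval) auto
    then show "bil_B Yl Yu n x y \<in> {0..1}"
      unfolding bil_B_eq_convex_combination
      using convexD[OF convex_real_interval(5)[of 0 1], of _ _ "1 - x" x] x by simp
  qed
  then show ?thesis by (auto simp: unit_square_def bil_w_def)
qed

text \<open>
  The increment is split at the intermediate point \<open>(x', y)\<close>: a horizontal move at height \<open>y\<close> is
  governed by the difference of the two end segments at that height, a vertical one at abscissa
  \<open>x'\<close> by the length of the vertical section there.
\<close>

lemma bil_B_increment_le:
  assumes Y: "\<And>j. j \<in> {n - 1, n} \<Longrightarrow> 0 \<le> Yl j \<and> Yl j \<le> Yu j \<and> Yu j \<le> 1"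
    and y: "y \<in> {0..1}" and x': "x' \<in> {0..1}"
  shows "\<bar>bil_B Yl Yu n x y - bil_B Yl Yu n x' y'\<bar>
           \<le> \<bar>x - x'\<bar> + max (bil_s Yl Yu (n - 1)) (bil_s Yl Yu n) * \<bar>y - y'\<bar>"
proof -
  let ?p = "\<lambda>j. Yl j + bil_s Yl Yu j * y"
  let ?s = "(1 - x') * bil_s Yl Yu (n - 1) + x' * bil_s Yl Yu n"
  let ?m = "max (bil_s Yl Yu (n - 1)) (bil_s Yl Yu n)"
  have "?p j \<in> {0..1}" if "j \<in> {n - 1, n}" for j
    using Y[OF that] y by (intro vertical_segment_in_unit_interval) auto
  then have "?p (n - 1) \<in> {0..1}" "?p n \<in> {0..1}" by blast+
  then have horizontal: "\<bar>?p n - ?p (n - 1)\<bar> \<le> 1" unfolding atLeastAtMost_iff by linarith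
  have "0 \<le> bil_s Yl Yu (n - 1)" "0 \<le> bil_s Yl Yu n"
    using Y by (auto simp: bil_s_def)
  then have "0 \<le> ?s" using x' by simp
  moreover have "?s \<le> ?m" using x' by (intro convex_bound_le) auto
  ultimately have vertical: "\<bar>?s\<bar> \<le> ?m" by linarith
  have "bil_B Yl Yu n x y - bil_B Yl Yu n x' y'
          = (?p n - ?p (n - 1)) * (x - x') + ?s * (y - y')"
    by (simp add: bil_B_eq_convex_combination algebra_simps)
  also have "\<bar>\<dots>\<bar> \<le> \<bar>?p n - ?p (n - 1)\<bar> * \<bar>x - x'\<bar> + \<bar>?s\<bar> * \<bar>y - y'\<bar>"
    unfolding abs_mult[symmetric] by (rule abs_triangle_ineq)
  also have "\<dots> \<le> 1 * \<bar>x - x'\<bar> + ?m * \<bar>y - y'\<bar>"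
    by (intro add_mono mult_right_mono horizontal vertical) auto
  finally show ?thesis by simp
qed

text \<open>
  The term \<open>\<beta>\<close> next to \<open>\<lambda>\<^sub>n\<close> is the price of the shear: a horizontal displacement may be passed
  on in full to the second coordinate, where it counts with weight \<open>\<beta>\<close>.
\<close>

lemma bil_w_d1_le:
  assumes X: "X (n - 1) \<le> X n"
    and Y: "\<And>j. j \<in> {n - 1, n} \<Longrightarrow> 0 \<le> Yl j \<and> Yl j \<le> Yu j \<and> Yu j \<le> 1"
    and "0 \<le> \<beta>" and u: "u \<in> unit_square" and v: "v \<in> unit_square"
  shows "d1 1 \<beta> (bil_w X Yl Yu n u) (bil_w X Yl Yu n v)
           \<le> max (X n - X (n - 1) + \<beta>) (max (bil_s Yl Yu (n - 1)) (bil_s Yl Yu n)) * d1 1 \<beta> u v"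
proof -
  obtain x y x' y' where uv: "u = (x, y)" "v = (x', y')" by (cases u, cases v)
  let ?l = "X n - X (n - 1)"
  let ?m = "max (bil_s Yl Yu (n - 1)) (bil_s Yl Yu n)"
  have "\<bar>bil_l X n x - bil_l X n x'\<bar> = ?l * \<bar>x - x'\<bar>"
    using X by (simp add: bil_l_def abs_mult flip: right_diff_distrib)
  moreover have "\<bar>bil_B Yl Yu n x y - bil_B Yl Yu n x' y'\<bar> \<le> \<bar>x - x'\<bar> + ?m * \<bar>y - y'\<bar>"
    using u v by (intro bil_B_increment_le Y) (auto simp: uv unit_square_def)
  then have "\<beta> * \<bar>bil_B Yl Yu n x y - bil_B Yl Yu n x' y'\<bar> \<le> \<beta> * (\<bar>x - x'\<bar> + ?m * \<bar>y - y'\<bar>)"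
    using \<open>0 \<le> \<beta>\<close> by (rule mult_left_mono)
  ultimately have "d1 1 \<beta> (bil_w X Yl Yu n u) (bil_w X Yl Yu n v)
      \<le> (?l + \<beta>) * \<bar>x - x'\<bar> + ?m * (\<beta> * \<bar>y - y'\<bar>)"
    by (simp add: uv bil_w_def d1_def algebra_simps)
  also have "\<dots> \<le> max (?l + \<beta>) ?m * \<bar>x - x'\<bar> + max (?l + \<beta>) ?m * (\<beta> * \<bar>y - y'\<bar>)"
    using \<open>0 \<le> \<beta>\<close> by (intro add_mono mult_right_mono) auto
  also have "\<dots> = max (?l + \<beta>) ?m * d1 1 \<beta> u v"
    by (simp add: uv d1_def distrib_left)
  finally show ?thesis .
qed

section \<open>Contractivity of the bilinear system\<close>

theorem theorem5:
  fixes N :: nat and X Yl Yu :: "nat \<Rightarrow> real" and \<beta> :: real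
  assumes "N > 1"
    and "X 0 = 0" and "X N = 1"
    and "\<forall>n\<in>{1..N}. X (n - 1) < X n"
    and "\<forall>j\<le>N. 0 \<le> Yl j \<and> Yl j \<le> Yu j \<and> Yu j < 1"
    and "0 < \<beta>"
    and "\<forall>n\<in>{1..N}. \<beta> < (1 - lipschitz_const {0..1} (bil_l X n)) / 2"
  shows "contractive_ifs unit_square (d1 1 \<beta>) N (bil_w X Yl Yu)"
proof (rule contractive_ifsI)
  show "Metric_space unit_square (d1 1 \<beta>)" "Metric_space.mcomplete unit_square (d1 1 \<beta>)"
    using \<open>0 < \<beta>\<close> by (simp_all add: Metric_space_d1 mcomplete_d1_unit_square)
  have mono: "X i \<le> X j" if "i \<le> j" "j \<le> N" for i j
    using that
  proof (induction rule: dec_induct)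
    case (step k)
    then show ?case using assms(4)[rule_format, of "Suc k"] by simp
  qed simp
  fix n assume n: "n \<in> {1..N}"
  have Y: "0 \<le> Yl j \<and> Yl j \<le> Yu j \<and> Yu j < 1" if "j \<in> {n - 1, n}" for j
    using that n assms(5) by auto
  then have Y_le: "0 \<le> Yl j \<and> Yl j \<le> Yu j \<and> Yu j \<le> 1" if "j \<in> {n - 1, n}" for j
    using that by force
  have X: "0 \<le> X (n - 1)" "X (n - 1) \<le> X n" "X n \<le> 1"
    using mono[of 0 "n - 1"] mono[of "n - 1" n] mono[of n N] n assms(2,3) by auto
  show "bil_w X Yl Yu n ` unit_square \<subseteq> unit_square"
    by (intro bil_w_in_unit_square X Y_le)
  have "X n - X (n - 1) + \<beta> < 1"
    using assms(7)[rule_format, OF n] slope_le_lipschitz_const_bil_l[of X n] \<open>0 < \<beta>\<close> by argo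
  moreover have "bil_s Yl Yu j < 1" if "j \<in> {n - 1, n}" for j
    using Y[OF that] by (simp add: bil_s_def)
  ultimately show "max (X n - X (n - 1) + \<beta>) (max (bil_s Yl Yu (n - 1)) (bil_s Yl Yu n)) < 1"
    by simp
  fix u v assume "u \<in> unit_square" "v \<in> unit_square"
  then show "d1 1 \<beta> (bil_w X Yl Yu n u) (bil_w X Yl Yu n v)
      \<le> max (X n - X (n - 1) + \<beta>) (max (bil_s Yl Yu (n - 1)) (bil_s Yl Yu n)) * d1 1 \<beta> u v"
    using X(2) \<open>0 < \<beta>\<close> by (intro bil_w_d1_le Y_le) auto
qed

end
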